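(* Let $X$ be an Alexander quandle, given by an abelian group $X$ with an automorphism $t:X\to X$, such that $1-t:X\to X$ is invertible. Then the correspondence $\mathbb{Z}\langle X^2\rangle\ni(x,y)\mapsto x\otimes(1-t)y\in X\otimes_{\mathbb{Z}}X$ gives rise to an isomorphism $$H_2^Q(X;\mathbb{Z})\cong\frac{X\otimes_{\mathbb{Z}}X}{\{x\otimes y-y\otimes tx\}_{x,y\in X}}.$$
   Context: An Alexander quandle is an abelian group $X$ with a group automorphism $t:X\to X$ and the binary operation $x*y=tx+(1-t)y$. For a quandle $X$, let $C_n^R(X)=\mathbb{Z}\langle X^n\rangle$ be the free abelian group on $X^n$, with $\partial_2^R(x,y)=(x)-(x*y)$ and $\partial_3^R(x,y,z)=(x,z)-(x*y,z)-(x,y)+(x*z,y*z)$. The second quandle homology $H_2^Q(X;\mathbb{Z})$ is the quotient of $\mathrm{Ker}(\partial_2^R)$ by the subgroup generated by $\mathrm{Im}(\partial_3^R)$ and all $(a,a)$ with $a\in X$. A quotient by a set of elements means the quotient by the subgroup they generate. *)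

theory Defs
  imports "HOL-Algebra.Free_Abelian_Groups"
begin

text \<open>
  Abelian groups are written multiplicatively (\<^locale>\<open>comm_group\<close>), except that in
  \<^term>\<open>free_Abelian_group S\<close> the operation is addition of finitely supported functions.
\<close>

subsection \<open>Quotients by a set of elements\<close>

definition quotient_by :: "('a, 'b) monoid_scheme \<Rightarrow> 'a set \<Rightarrow> 'a set monoid" where
  "quotient_by G S = G Mod generate G S"

definition quotient_class :: "('a, 'b) monoid_scheme \<Rightarrow> 'a set \<Rightarrow> 'a \<Rightarrow> 'a set" where
  "quotient_class G S a = generate G S #>\<^bsub>G\<^esub> a"

lemma comm_group_quotient_by:
  assumes "comm_group G" "S \<subseteq> carrier G"
  shows "comm_group (quotient_by G S)"
  unfolding quotient_by_def
  using assms by (intro comm_group.abelian_FactGroup group.generate_is_subgroup comm_group.axioms)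

lemma quotient_class_hom:
  assumes "comm_group G" "S \<subseteq> carrier G"
  shows "quotient_class G S \<in> hom G (quotient_by G S)"
proof -
  have "generate G S \<lhd> G"
    using assms by (intro comm_group.subgroup_imp_normal group.generate_is_subgroup comm_group.axioms)
  from normal.r_coset_hom_Mod[OF this] show ?thesis
    by (simp add: quotient_by_def quotient_class_def[abs_def])
qed

subsection \<open>Tensor products over the integers\<close>

definition tensor_relations ::
    "('a, 'c) monoid_scheme \<Rightarrow> ('b, 'd) monoid_scheme \<Rightarrow> ('a \<times> 'b \<Rightarrow>\<^sub>0 int) set" where
  "tensor_relations G H =
     {frag_of (x \<otimes>\<^bsub>G\<^esub> x', y) - frag_of (x, y) - frag_of (x', y) | x x' y.
        x \<in> carrier G \<and> x' \<in> carrier G \<and> y \<in> carrier H} \<union>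
     {frag_of (x, y \<otimes>\<^bsub>H\<^esub> y') - frag_of (x, y) - frag_of (x, y') | x y y'.
        x \<in> carrier G \<and> y \<in> carrier H \<and> y' \<in> carrier H}"

definition tensor_product ::
    "('a, 'c) monoid_scheme \<Rightarrow> ('b, 'd) monoid_scheme \<Rightarrow> ('a \<times> 'b \<Rightarrow>\<^sub>0 int) set monoid" where
  "tensor_product G H =
     quotient_by (free_Abelian_group (carrier G \<times> carrier H)) (tensor_relations G H)"

definition pure_tensor ::
    "('a, 'c) monoid_scheme \<Rightarrow> ('b, 'd) monoid_scheme \<Rightarrow> 'a \<Rightarrow> 'b \<Rightarrow> ('a \<times> 'b \<Rightarrow>\<^sub>0 int) set" where
  "pure_tensor G H x y =
     quotient_class (free_Abelian_group (carrier G \<times> carrier H)) (tensor_relations G H)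
       (frag_of (x, y))"

lemma tensor_relations_subset:
  assumes "group G" "group H"
  shows "tensor_relations G H \<subseteq> carrier (free_Abelian_group (carrier G \<times> carrier H))"
proof -
  interpret G: group G by fact
  interpret H: group H by fact
  let ?F = "free_Abelian_group (carrier G \<times> carrier H)"
  have *: "a - b - c \<in> carrier ?F" if "a \<in> carrier ?F" "b \<in> carrier ?F" "c \<in> carrier ?F" for a b c
    using that keys_diff[of "a - b" c] keys_diff[of a b]
    by (simp only: carrier_free_Abelian_group_iff) blast
  show ?thesis
    unfolding tensor_relations_def
    by (intro Un_least subsetI; elim CollectE exE conjE; hypsubst; intro *) auto
qed

lemma comm_group_tensor_product:
  assumes "group G" "group H"
  shows "comm_group (tensor_product G H)"
  unfolding tensor_product_def
  by (intro comm_group_quotient_by abelian_free_Abelian_group tensor_relations_subset assms)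

subsection \<open>Quandles and their second homology\<close>

locale quandle =
  fixes Q :: "'a set" and qop :: "'a \<Rightarrow> 'a \<Rightarrow> 'a"
  assumes idem: "x \<in> Q \<Longrightarrow> qop x x = x"
    and bij: "y \<in> Q \<Longrightarrow> bij_betw (\<lambda>x. qop x y) Q Q"
    and distrib: "\<lbrakk>x \<in> Q; y \<in> Q; z \<in> Q\<rbrakk> \<Longrightarrow> qop (qop x y) z = qop (qop x z) (qop y z)"

definition rack_boundary2 :: "('a \<Rightarrow> 'a \<Rightarrow> 'a) \<Rightarrow> ('a \<times> 'a \<Rightarrow>\<^sub>0 int) \<Rightarrow> ('a \<Rightarrow>\<^sub>0 int)" where
  "rack_boundary2 qop = frag_extend (\<lambda>(x, y). frag_of x - frag_of (qop x y))"

definition rack_boundary3 ::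
    "('a \<Rightarrow> 'a \<Rightarrow> 'a) \<Rightarrow> ('a \<times> 'a \<times> 'a \<Rightarrow>\<^sub>0 int) \<Rightarrow> ('a \<times> 'a \<Rightarrow>\<^sub>0 int)" where
  "rack_boundary3 qop = frag_extend (\<lambda>(x, y, z).
     frag_of (x, z) - frag_of (qop x y, z) - frag_of (x, y) + frag_of (qop x z, qop y z))"

definition rack_cycles2 :: "'a set \<Rightarrow> ('a \<Rightarrow> 'a \<Rightarrow> 'a) \<Rightarrow> ('a \<times> 'a \<Rightarrow>\<^sub>0 int) set" where
  "rack_cycles2 Q qop =
     kernel (free_Abelian_group (Q \<times> Q)) (free_Abelian_group Q) (rack_boundary2 qop)"

text \<open>
  The cycles already form a subgroup, so \<^const>\<open>subgroup_generated\<close> only restricts the carrier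
  (lemma \<open>carrier_rack_cycle_group2\<close> below).
\<close>

definition rack_cycle_group2 :: "'a set \<Rightarrow> ('a \<Rightarrow> 'a \<Rightarrow> 'a) \<Rightarrow> ('a \<times> 'a \<Rightarrow>\<^sub>0 int) monoid" where
  "rack_cycle_group2 Q qop =
     subgroup_generated (free_Abelian_group (Q \<times> Q)) (rack_cycles2 Q qop)"

definition quandle_relations2 :: "'a set \<Rightarrow> ('a \<Rightarrow> 'a \<Rightarrow> 'a) \<Rightarrow> ('a \<times> 'a \<Rightarrow>\<^sub>0 int) set" where
  "quandle_relations2 Q qop =
     rack_boundary3 qop ` carrier (free_Abelian_group (Q \<times> Q \<times> Q)) \<union> {frag_of (a, a) | a. a \<in> Q}"

definition quandle_homology2 ::
    "'a set \<Rightarrow> ('a \<Rightarrow> 'a \<Rightarrow> 'a) \<Rightarrow> ('a \<times> 'a \<Rightarrow>\<^sub>0 int) set monoid" where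
  "quandle_homology2 Q qop = quotient_by (rack_cycle_group2 Q qop) (quandle_relations2 Q qop)"

definition quandle_homology_class2 ::
    "'a set \<Rightarrow> ('a \<Rightarrow> 'a \<Rightarrow> 'a) \<Rightarrow> ('a \<times> 'a \<Rightarrow>\<^sub>0 int) \<Rightarrow> ('a \<times> 'a \<Rightarrow>\<^sub>0 int) set" where
  "quandle_homology_class2 Q qop =
     quotient_class (rack_cycle_group2 Q qop) (quandle_relations2 Q qop)"

lemma rack_boundary2_hom:
  assumes "quandle Q qop"
  shows "rack_boundary2 qop \<in> hom (free_Abelian_group (Q \<times> Q)) (free_Abelian_group Q)"
proof -
  interpret quandle Q qop by fact
  have cl: "qop x y \<in> Q" if "x \<in> Q" "y \<in> Q" for x y
    using bij_betwE[OF bij[OF that(2)]] that(1) by blast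
  have "Poly_Mapping.keys (rack_boundary2 qop c) \<subseteq> Q"
    if c: "Poly_Mapping.keys c \<subseteq> Q \<times> Q" for c
  proof -
    have *: "Poly_Mapping.keys (frag_of x - frag_of (qop x y)) \<subseteq> Q" if "x \<in> Q" "y \<in> Q" for x y
      using keys_diff[of "frag_of x" "frag_of (qop x y)"] that cl by auto
    show ?thesis
      unfolding rack_boundary2_def
      using c * by (intro order.trans[OF keys_frag_extend]) fast
  qed
  then show ?thesis
    by (auto simp: hom_def rack_boundary2_def frag_extend_add)
qed

lemma carrier_rack_cycle_group2:
  assumes "quandle Q qop"
  shows "carrier (rack_cycle_group2 Q qop) = rack_cycles2 Q qop"
proof -
  interpret group_hom "free_Abelian_group (Q \<times> Q)" "free_Abelian_group Q" "rack_boundary2 qop"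
    by (simp add: group_hom_def group_hom_axioms_def rack_boundary2_hom assms)
  show ?thesis
    unfolding rack_cycle_group2_def rack_cycles2_def
    by (rule subgroup.carrier_subgroup_generated_subgroup[OF subgroup_kernel])
qed

lemma quandle_relations2_subset:
  assumes "quandle Q qop"
  shows "quandle_relations2 Q qop \<subseteq> rack_cycles2 Q qop"
proof -
  interpret quandle Q qop by fact
  let ?d = "\<lambda>(x, y, z).
     frag_of (x, z) - frag_of (qop x y, z) - frag_of (x, y) + frag_of (qop x z, qop y z)"
  interpret h: group_hom "free_Abelian_group (Q \<times> Q)" "free_Abelian_group Q" "rack_boundary2 qop"
    by (simp add: group_hom_def group_hom_axioms_def rack_boundary2_hom assms)
  have sub: "subgroup (rack_cycles2 Q qop) (free_Abelian_group (Q \<times> Q))"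
    unfolding rack_cycles2_def by (rule h.subgroup_kernel)
  have cl: "qop x y \<in> Q" if "x \<in> Q" "y \<in> Q" for x y
    using bij_betwE[OF bij[OF that(2)]] that(1) by blast
  have b2: "rack_boundary2 qop (frag_of (x, y)) = frag_of x - frag_of (qop x y)" for x y
    by (simp add: rack_boundary2_def)
  have b2diff: "rack_boundary2 qop (a - b) = rack_boundary2 qop a - rack_boundary2 qop b"
    and b2add: "rack_boundary2 qop (a + b) = rack_boundary2 qop a + rack_boundary2 qop b" for a b
    by (simp_all add: rack_boundary2_def frag_extend_diff frag_extend_add)
  have gen: "?d p \<in> rack_cycles2 Q qop" if "p \<in> Q \<times> Q \<times> Q" for p
  proof -
    obtain x y z where p: "p = (x, y, z)" "x \<in> Q" "y \<in> Q" "z \<in> Q" using \<open>p \<in> _\<close> by auto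
    have "Poly_Mapping.keys (?d p) \<subseteq> Q \<times> Q"
      unfolding p(1) case_prod_conv
      by (intro order.trans[OF keys_add] Un_least order.trans[OF keys_diff])
         (use p cl in auto)
    moreover have "rack_boundary2 qop (?d p) = 0"
      using distrib[of x y z] p by (simp add: b2diff b2add b2)
    ultimately show ?thesis by (simp add: rack_cycles2_def kernel_def)
  qed
  have "rack_boundary3 qop c \<in> rack_cycles2 Q qop" if "Poly_Mapping.keys c \<subseteq> Q \<times> Q \<times> Q" for c
    using that
  proof (induction c rule: frag_induction)
    case zero
    show ?case using subgroup.one_closed[OF sub] by (simp add: rack_boundary3_def)
  next
    case (one p)
    then show ?case using gen[of p] by (simp add: rack_boundary3_def)
  next
    case (diff a b)
    have "rack_boundary2 qop (rack_boundary3 qop a - rack_boundary3 qop b) = 0"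
      using diff by (simp add: b2diff rack_cycles2_def kernel_def)
    moreover have "Poly_Mapping.keys (rack_boundary3 qop a - rack_boundary3 qop b) \<subseteq> Q \<times> Q"
      using diff by (intro order.trans[OF keys_diff]) (simp add: rack_cycles2_def kernel_def)
    ultimately show ?case
      by (simp add: rack_cycles2_def kernel_def rack_boundary3_def frag_extend_diff)
  qed
  moreover have "frag_of (a, a) \<in> rack_cycles2 Q qop" if "a \<in> Q" for a
    using that by (simp add: rack_cycles2_def kernel_def b2 idem)
  ultimately show ?thesis
    by (auto simp: quandle_relations2_def)
qed

subsection \<open>Alexander quandles\<close>

text \<open>
  In additive notation, the endomorphism $1 - t$ and the operation $x * y = t x + (1 - t) y$.
\<close>

definition one_minus :: "('a, 'b) monoid_scheme \<Rightarrow> ('a \<Rightarrow> 'a) \<Rightarrow> 'a \<Rightarrow> 'a" where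
  "one_minus A t x = x \<otimes>\<^bsub>A\<^esub> inv\<^bsub>A\<^esub> (t x)"

definition alexander_op :: "('a, 'b) monoid_scheme \<Rightarrow> ('a \<Rightarrow> 'a) \<Rightarrow> 'a \<Rightarrow> 'a \<Rightarrow> 'a" where
  "alexander_op A t x y = t x \<otimes>\<^bsub>A\<^esub> one_minus A t y"

lemma quandle_alexander:
  assumes "comm_group A" "t \<in> iso A A"
  shows "quandle (carrier A) (alexander_op A t)"
proof -
  interpret comm_group A by fact
  have th: "t \<in> hom A A" and tb: "bij_betw t (carrier A) (carrier A)"
    using assms(2) by (auto simp: iso_def)
  interpret t: group_hom A A t
    by (simp add: group_hom_def group_hom_axioms_def th is_group)
  show ?thesis
  proof
    fix x assume "x \<in> carrier A"
    then show "alexander_op A t x x = x"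
      by (simp add: alexander_op_def one_minus_def m_lcomm)
  next
    fix y assume y: "y \<in> carrier A"
    have "bij_betw (\<lambda>a. a \<otimes>\<^bsub>A\<^esub> one_minus A t y) (carrier A) (carrier A)"
      by (rule bij_betw_byWitness[where f' = "\<lambda>a. a \<otimes>\<^bsub>A\<^esub> inv\<^bsub>A\<^esub> (one_minus A t y)"])
         (use y in \<open>auto simp: one_minus_def m_assoc\<close>)
    from bij_betw_trans[OF tb this]
    show "bij_betw (\<lambda>x. alexander_op A t x y) (carrier A) (carrier A)"
      by (simp add: alexander_op_def[abs_def] comp_def)
  next
    fix x y z assume xyz: "x \<in> carrier A" "y \<in> carrier A" "z \<in> carrier A"
    have cancel: "u \<otimes>\<^bsub>A\<^esub> (w \<otimes>\<^bsub>A\<^esub> (v \<otimes>\<^bsub>A\<^esub> (inv\<^bsub>A\<^esub> u \<otimes>\<^bsub>A\<^esub> (inv\<^bsub>A\<^esub> u \<otimes>\<^bsub>A\<^esub> (p \<otimes>\<^bsub>A\<^esub> inv\<^bsub>A\<^esub> v))))) =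
        w \<otimes>\<^bsub>A\<^esub> (inv\<^bsub>A\<^esub> u \<otimes>\<^bsub>A\<^esub> p)"
      if "u \<in> carrier A" "v \<in> carrier A" "w \<in> carrier A" "p \<in> carrier A" for u v w p
    proof -
      have "u \<otimes>\<^bsub>A\<^esub> (w \<otimes>\<^bsub>A\<^esub> (v \<otimes>\<^bsub>A\<^esub> (inv\<^bsub>A\<^esub> u \<otimes>\<^bsub>A\<^esub> (inv\<^bsub>A\<^esub> u \<otimes>\<^bsub>A\<^esub> (p \<otimes>\<^bsub>A\<^esub> inv\<^bsub>A\<^esub> v))))) =
          (u \<otimes>\<^bsub>A\<^esub> inv\<^bsub>A\<^esub> u) \<otimes>\<^bsub>A\<^esub> ((v \<otimes>\<^bsub>A\<^esub> inv\<^bsub>A\<^esub> v) \<otimes>\<^bsub>A\<^esub> (w \<otimes>\<^bsub>A\<^esub> (inv\<^bsub>A\<^esub> u \<otimes>\<^bsub>A\<^esub> p)))"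
        using that by (simp only: m_ac m_closed inv_closed)
      then show ?thesis using that by simp
    qed
    show "alexander_op A t (alexander_op A t x y) z =
        alexander_op A t (alexander_op A t x z) (alexander_op A t y z)"
      using xyz by (simp add: alexander_op_def one_minus_def inv_mult_group m_ac cancel)
  qed
qed

text \<open>The elements $x \<otimes> y - y \<otimes> t x$ of the tensor square, whose group is written multiplicatively.\<close>

definition alexander_tensor_relations ::
    "('a, 'b) monoid_scheme \<Rightarrow> ('a \<Rightarrow> 'a) \<Rightarrow> ('a \<times> 'a \<Rightarrow>\<^sub>0 int) set set" where
  "alexander_tensor_relations A t =
     {pure_tensor A A x y \<otimes>\<^bsub>tensor_product A A\<^esub> inv\<^bsub>tensor_product A A\<^esub> pure_tensor A A y (t x) | x y.
        x \<in> carrier A \<and> y \<in> carrier A}"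

end

theory Submission
  imports Defs
begin

text \<open>
  Let $s = 1 - t$ and let $\Phi$ be the automorphism $(x, y) \mapsto (x, s y)$ of
  $\mathbb{Z}\langle X^2\rangle$. A retraction $\rho$ onto the 2-cycles turns the inverse
  isomorphism into $x \otimes y \mapsto f(x, y) = [\rho (x, s^{-1} y)]$, and everything comes
  down to the bilinearity of $f$ and $f(x, y) = f(y, t x)$ in homology. The quandle relations read
  $f(0, c) = 0$, $f(x, s x) = 0$ and
  $f(x, c) - f(t x + b, c) - f(x, b) + f(t x + c, t b + s c) = 0$.
  They imply that $g(a, x) = f(a, t x)$ is a 2-cocycle of the group $X$. The commutator pairing
  $\omega(a, b) = g(a, b) - g(b, a)$ of any 2-cocycle on an abelian group is bilinear, and the
  relations further give $g(a, s v) = \omega(t v, a)$, so $g$ and $f$ are bilinear as well.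
\<close>

subsection \<open>Subsets of abelian groups closed under subtraction\<close>

text \<open>Chains live in a type of class \<open>ab_group_add\<close>, so congruence modulo a
  subgroup is expressed by membership of a difference. Congruences can then be added and subtracted
  inside \<open>K\<close> without forming a quotient group.\<close>

locale diff_closed =
  fixes K :: "'v::ab_group_add set"
  assumes zero_mem: "0 \<in> K"
    and diff_mem: "\<lbrakk>a \<in> K; b \<in> K\<rbrakk> \<Longrightarrow> a - b \<in> K"
begin

lemma minus_mem: "a \<in> K \<Longrightarrow> - a \<in> K"
  using diff_mem[OF zero_mem, of a] by simp

lemma add_mem: "\<lbrakk>a \<in> K; b \<in> K\<rbrakk> \<Longrightarrow> a + b \<in> K"
  using diff_mem[of a "- b"] minus_mem by simp

lemma diff_mem_trans: "\<lbrakk>a - b \<in> K; b - c \<in> K\<rbrakk> \<Longrightarrow> a - c \<in> K"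
  using add_mem[of "a - b" "b - c"] by simp

end

subsection \<open>Cocycles of Alexander quandles modulo a subgroup\<close>

text \<open>Take the cocycle identity for (a, c, b) and subtract those for (a, b, c) and (c, a, b).
  Since the group is commutative, everything except the commutator terms cancels.\<close>

lemma (in comm_group) cocycle_commutator_additive:
  fixes g :: "'a \<Rightarrow> 'a \<Rightarrow> 'v::ab_group_add"
  assumes "diff_closed K"
    and cocycle: "\<And>a x w. \<lbrakk>a \<in> carrier G; x \<in> carrier G; w \<in> carrier G\<rbrakk> \<Longrightarrow>
      g x w - g (a \<otimes> x) w + g a (x \<otimes> w) - g a x \<in> K"
    and a: "a \<in> carrier G" and b: "b \<in> carrier G" and c: "c \<in> carrier G"
  shows "(g (a \<otimes> b) c - g c (a \<otimes> b)) - (g a c - g c a) - (g b c - g c b) \<in> K"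
proof -
  interpret diff_closed K by fact
  have "g b c - g (a \<otimes> b) c + g a (b \<otimes> c) - g a b \<in> K"
    and "g a b - g (c \<otimes> a) b + g c (a \<otimes> b) - g c a \<in> K"
    and "g c b - g (a \<otimes> c) b + g a (c \<otimes> b) - g a c \<in> K"
    using a b c by (intro cocycle; simp)+
  from diff_mem[OF this(3) add_mem[OF this(1,2)]] show ?thesis
    using a b c by (simp add: m_comm algebra_simps)
qed

section \<open>The automorphisms t and 1 - t\<close>

locale alexander = comm_group A for A (structure) +
  fixes t :: "'a \<Rightarrow> 'a"
  assumes t_iso: "t \<in> iso A A"
    and one_minus_iso: "one_minus A t \<in> iso A A"
begin

abbreviation s :: "'a \<Rightarrow> 'a" where "s \<equiv> one_minus A t"

definition r :: "'a \<Rightarrow> 'a" where "r = inv_into (carrier A) s"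

lemma t_hom: "t \<in> hom A A" and s_hom: "s \<in> hom A A"
  using t_iso one_minus_iso by (auto simp: iso_def)

sublocale t: group_hom A A t
  by (simp add: group_hom_def group_hom_axioms_def t_hom)

sublocale s: group_hom A A s
  by (simp add: group_hom_def group_hom_axioms_def s_hom)

lemma s_bij: "bij_betw s (carrier A) (carrier A)" and t_bij: "bij_betw t (carrier A) (carrier A)"
  using one_minus_iso t_iso by (auto simp: iso_def)

lemma s_r [simp]: "x \<in> carrier A \<Longrightarrow> s (r x) = x"
  using s_bij by (simp add: r_def bij_betw_inv_into_right)

lemma r_s [simp]: "x \<in> carrier A \<Longrightarrow> r (s x) = x"
  using s_bij by (simp add: r_def bij_betw_inv_into_left)

lemma r_closed [simp]: "x \<in> carrier A \<Longrightarrow> r x \<in> carrier A"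
  using bij_betwE[OF bij_betw_inv_into[OF s_bij]] by (simp add: r_def)

lemma r_mult [simp]: "\<lbrakk>x \<in> carrier A; y \<in> carrier A\<rbrakk> \<Longrightarrow> r (x \<otimes> y) = r x \<otimes> r y"
  using r_s[of "r x \<otimes> r y"] by simp

lemma t_s: "x \<in> carrier A \<Longrightarrow> t (s x) = s (t x)"
  by (simp add: one_minus_def)

lemma t_r: "x \<in> carrier A \<Longrightarrow> t (r x) = r (t x)"
  using r_s[of "t (r x)"] t_s[of "r x"] by simp

lemma t_mult_s [simp]: "x \<in> carrier A \<Longrightarrow> t x \<otimes> s x = x"
  by (simp add: one_minus_def m_lcomm)

lemma s_mult_t [simp]: "x \<in> carrier A \<Longrightarrow> s x \<otimes> t x = x"
  using t_mult_s[of x] by (simp add: m_comm del: t_mult_s)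

end

locale alexander_mod = alexander A t + diff_closed K
  for A :: "('a, 'b) monoid_scheme" (structure) and t and K :: "'v::ab_group_add set"

text \<open>In the coordinates (x, (1 - t) y) the product x * y reads t x + b with b = (1 - t) y.
  Thus \<open>boundary\<close> comes from \<open>rack_boundary3\<close> at the triple
  (\<open>x\<close>, \<open>r b\<close>, \<open>r c\<close>) and \<open>diag\<close> from the
  degenerate pair (\<open>x\<close>, \<open>x\<close>), while \<open>one_left\<close> is a
  normalization supplied by the retraction onto cycles.\<close>

locale alexander_cocycle = alexander_mod A t K
  for A :: "('a, 'b) monoid_scheme" (structure) and t and K :: "'v::ab_group_add set" +
  fixes f :: "'a \<Rightarrow> 'a \<Rightarrow> 'v"
  assumes one_left: "x \<in> carrier A \<Longrightarrow> f \<one> x \<in> K"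
    and diag: "x \<in> carrier A \<Longrightarrow> f x (s x) \<in> K"
    and boundary: "\<lbrakk>x \<in> carrier A; b \<in> carrier A; c \<in> carrier A\<rbrakk> \<Longrightarrow>
      f x c - f (t x \<otimes> b) c - f x b + f (t x \<otimes> c) (t b \<otimes> s c) \<in> K"
begin

text \<open>This is \<open>boundary\<close> at x = 0, where \<open>one_left\<close> removes the two
  terms with first argument 0.\<close>

lemma swap:
  assumes "b \<in> carrier A" "c \<in> carrier A"
  shows "f b c - f c (t b \<otimes> s c) \<in> K"
  using diff_mem[OF diff_mem[OF one_left[OF assms(2)] one_left[OF assms(1)]]
      boundary[OF one_closed assms]] assms
  by (simp add: algebra_simps)

lemma one_right: "b \<in> carrier A \<Longrightarrow> f b \<one> \<in> K"
  using add_mem[OF swap[of b \<one>] one_left[of "t b"]] by simp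

text \<open>This is \<open>boundary\<close> at c = 0, where \<open>one_right\<close> removes the
  first two terms.\<close>

lemma invariant:
  assumes "x \<in> carrier A" "b \<in> carrier A"
  shows "f x b - f (t x) (t b) \<in> K"
  using diff_mem[OF diff_mem[OF one_right[OF assms(1)] one_right[of "t x \<otimes> b"]]
      boundary[of x b \<one>]] assms
  by (simp add: algebra_simps)

text \<open>
  Substituting $b = a + (1 - t) x$ in the boundary relation makes \<open>g\<close> a group 2-cocycle.
\<close>

definition g :: "'a \<Rightarrow> 'a \<Rightarrow> 'v" where "g a x = f a (t x)"

lemma cocycle:
  assumes a: "a \<in> carrier A" and x: "x \<in> carrier A" and w: "w \<in> carrier A"
  shows "g x w - g (a \<otimes> x) w + g a (x \<otimes> w) - g a x \<in> K"
proof -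
  have [simp]: "t x \<otimes> (a \<otimes> s x) = a \<otimes> x"
    using a x m_lcomm[of "t x" a "s x"] by simp
  have e: "t (a \<otimes> s x) \<otimes> s (t w) = t a \<otimes> s (t x \<otimes> t w)"
    using a x w by (simp add: t_s m_assoc)
  have e': "t a \<otimes> s (t x) = t (a \<otimes> s x)"
    using a x by (simp add: t_s)
  \<comment> \<open>For b = a + (1 - t) x the entry t x + b collapses to a + x.\<close>
  have 1: "f x (t w) - f (a \<otimes> x) (t w) - f x (a \<otimes> s x) + f (t x \<otimes> t w) (t a \<otimes> s (t x \<otimes> t w)) \<in> K"
    using boundary[of x "a \<otimes> s x" "t w"] a x w unfolding e by simp
  \<comment> \<open>Turns the last term of the boundary relation into g(a, x + w).\<close>
  have 2: "f a (t x \<otimes> t w) - f (t x \<otimes> t w) (t a \<otimes> s (t x \<otimes> t w)) \<in> K"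
    using swap[of a "t x \<otimes> t w"] a x w by simp
  \<comment> \<open>Facts 3 and 4 share their second term, so the remaining middle term f(x, a + (1
    - t) x) may be replaced by g(a, x).\<close>
  have 3: "f a (t x) - f (t x) (t (a \<otimes> s x)) \<in> K"
    using swap[of a "t x"] a x unfolding e'[symmetric] by simp
  have 4: "f x (a \<otimes> s x) - f (t x) (t (a \<otimes> s x)) \<in> K"
    using invariant[of x "a \<otimes> s x"] a x by simp
  show ?thesis
    using add_mem[OF add_mem[OF 1 2] diff_mem[OF 4 3]] a x w
    by (simp add: g_def algebra_simps)
qed

section \<open>The commutator pairing and the bilinearity of f\<close>

definition comm_pairing :: "'a \<Rightarrow> 'a \<Rightarrow> 'v" where "comm_pairing a b = g a b - g b a"

lemma comm_pairing_add_left: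
  "\<lbrakk>a \<in> carrier A; b \<in> carrier A; c \<in> carrier A\<rbrakk> \<Longrightarrow>
    comm_pairing (a \<otimes> b) c - comm_pairing a c - comm_pairing b c \<in> K"
  unfolding comm_pairing_def
  by (rule cocycle_commutator_additive[OF diff_closed_axioms]) (auto intro: cocycle)

lemma comm_pairing_add_right:
  assumes "a \<in> carrier A" "b \<in> carrier A" "c \<in> carrier A"
  shows "comm_pairing c (a \<otimes> b) - comm_pairing c a - comm_pairing c b \<in> K"
  using minus_mem[OF comm_pairing_add_left[OF assms]] by (simp add: comm_pairing_def algebra_simps)

text \<open>
  Comparing the cocycle identity for $(a, (1 - t) v, t v)$ with \<open>swap\<close> leaves
  $g((1 - t) v, t v) - g(a, (1 - t) v) + \omega(t v, a + (1 - t) v) \equiv 0$, where $\omega$ is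
  \<open>comm_pairing\<close>; the case $a = 0$ eliminates the first term.
\<close>

lemma g_s:
  assumes a: "a \<in> carrier A" and v: "v \<in> carrier A"
  shows "g a (s v) - comm_pairing (t v) a \<in> K"
proof -
  have *: "g (s v) (t v) - g b (s v) + comm_pairing (t v) (b \<otimes> s v) \<in> K"
    if b: "b \<in> carrier A" for b
  proof -
    have e: "t b \<otimes> s (t v) = t (b \<otimes> s v)"
      using b v by (simp add: t_s)
    have "f b (t v) - f (t v) (t (b \<otimes> s v)) \<in> K"
      using swap[of b "t v"] b v unfolding e by simp
    moreover have "g (s v) (t v) - g (b \<otimes> s v) (t v) + g b v - g b (s v) \<in> K"
      using cocycle[of b "s v" "t v"] b v by simp
    ultimately show ?thesis
      using diff_mem by (fastforce simp: g_def comm_pairing_def algebra_simps)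
  qed
  have "g \<one> (s v) \<in> K"
    using v one_left by (simp add: g_def)
  from add_mem[OF diff_mem[OF *[OF one_closed] *[OF a]] this]
  have "g a (s v) - comm_pairing (t v) (a \<otimes> s v) + comm_pairing (t v) (s v) \<in> K"
    using v by (simp add: algebra_simps)
  \<comment> \<open>Additivity absorbs the leftover pairing of t v with (1 - t) v.\<close>
  moreover have "comm_pairing (t v) (a \<otimes> s v) - comm_pairing (t v) a - comm_pairing (t v) (s v) \<in> K"
    using a v by (intro comm_pairing_add_right) auto
  ultimately show ?thesis
    using add_mem by (fastforce simp: algebra_simps)
qed

text \<open>Both t and 1 - t are onto: write y = t v and v = (1 - t) (r v), and apply
  \<open>g_s\<close> to r v, using t (r v) = r y. Hence f inherits bilinearity from the pairing,
  with the arguments exchanged.\<close>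

lemma f_pairing:
  assumes "x \<in> carrier A" "y \<in> carrier A"
  shows "f x y - comm_pairing (r y) x \<in> K"
proof -
  obtain v where v: "v \<in> carrier A" "y = t v"
    using assms(2) t_bij by (auto simp: bij_betw_def)
  then show ?thesis
    using g_s[of x "r v"] assms by (simp add: g_def t_r)
qed

lemma add_left:
  assumes "x \<in> carrier A" "x' \<in> carrier A" "y \<in> carrier A"
  shows "f (x \<otimes> x') y - f x y - f x' y \<in> K"
  using diff_mem[OF diff_mem[OF add_mem[OF f_pairing[of "x \<otimes> x'" y]
        comm_pairing_add_right[of x x' "r y"]] f_pairing[of x y]] f_pairing[of x' y]] assms
  by (simp add: algebra_simps)

lemma add_right:
  assumes "x \<in> carrier A" "y \<in> carrier A" "y' \<in> carrier A"
  shows "f x (y \<otimes> y') - f x y - f x y' \<in> K"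
  using diff_mem[OF diff_mem[OF add_mem[OF f_pairing[of x "y \<otimes> y'"]
        comm_pairing_add_left[of "r y" "r y'" x]] f_pairing[of x y]] f_pairing[of x y']] assms
  by (simp add: algebra_simps)

text \<open>By \<open>swap\<close> and additivity, f(x, y) is congruent to f(y, t x) + f(y, (1 - t)
  y), and the last term vanishes by \<open>diag\<close>.\<close>

lemma twisted_symmetric:
  assumes "x \<in> carrier A" "y \<in> carrier A"
  shows "f x y - f y (t x) \<in> K"
  using add_mem[OF add_mem[OF swap[OF assms] add_right[of y "t x" "s y"]] diag[of y]] assms
  by (simp add: algebra_simps)

end

section \<open>From twisted symmetric bilinear maps back to the quandle relations\<close>

locale alexander_bilinear = alexander_mod A t K
  for A :: "('a, 'b) monoid_scheme" (structure) and t and K :: "'v::ab_group_add set" +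
  fixes p :: "'a \<Rightarrow> 'a \<Rightarrow> 'v"
  assumes add_left: "\<lbrakk>x \<in> carrier A; x' \<in> carrier A; y \<in> carrier A\<rbrakk> \<Longrightarrow>
      p (x \<otimes> x') y - p x y - p x' y \<in> K"
    and add_right: "\<lbrakk>x \<in> carrier A; y \<in> carrier A; y' \<in> carrier A\<rbrakk> \<Longrightarrow>
      p x (y \<otimes> y') - p x y - p x y' \<in> K"
    and twisted_symmetric: "\<lbrakk>x \<in> carrier A; y \<in> carrier A\<rbrakk> \<Longrightarrow> p x y - p y (t x) \<in> K"
begin

text \<open>Split the second argument of p(x, x) as x = t x + (1 - t) x; twisted symmetry cancels
  p(x, x) against p(x, t x).\<close>

lemma diag:
  assumes "x \<in> carrier A" shows "p x (s x) \<in> K"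
  using diff_mem[OF twisted_symmetric[of x x] add_right[of x "t x" "s x"]] assms
  by (simp add: algebra_simps)

lemma one_left: "y \<in> carrier A \<Longrightarrow> p \<one> y \<in> K"
  using minus_mem[OF add_left[of \<one> \<one> y]] by simp

lemma boundary:
  assumes x: "x \<in> carrier A" and b: "b \<in> carrier A" and c: "c \<in> carrier A"
  shows "p x c - p (t x \<otimes> b) c - p x b + p (t x \<otimes> c) (t b \<otimes> s c) \<in> K"
proof -
  \<comment> \<open>Twisted symmetry applied twice gives invariance under t.\<close>
  have inv: "p x y - p (t x) (t y) \<in> K" if "y \<in> carrier A" for y
    using diff_mem_trans[OF twisted_symmetric[of x y] twisted_symmetric[of y "t x"]] x that by simp
  have 1: "p (t x \<otimes> b) c - p (t x) c - p b c \<in> K"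
    using add_left[of "t x" b c] x b c by simp
  have 2: "p (t x \<otimes> c) (t b \<otimes> s c) - p (t x) (t b \<otimes> s c) - p c (t b \<otimes> s c) \<in> K"
    using add_left[of "t x" c "t b \<otimes> s c"] x b c by simp
  have 3: "p (t x) (t b \<otimes> s c) - p (t x) (t b) - p (t x) (s c) \<in> K"
    using add_right[of "t x" "t b" "s c"] x b c by simp
  have 4: "p c (t b \<otimes> s c) - p c (t b) - p c (s c) \<in> K"
    using add_right[of c "t b" "s c"] x b c by simp
  \<comment> \<open>Uses c = t c + (1 - t) c.\<close>
  have 5: "p (t x) c - p (t x) (t c) - p (t x) (s c) \<in> K"
    using add_right[of "t x" "t c" "s c"] x b c by simp
  \<comment> \<open>What remains of the boundary relation once all sums are expanded: two invariance
    differences, one twisted symmetry and one diagonal term.\<close>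
  have L: "(p x c - p (t x) (t c)) - (p x b - p (t x) (t b)) - (p b c - p c (t b)) + p c (s c) \<in> K"
    by (rule add_mem[OF diff_mem[OF diff_mem[OF inv[OF c] inv[OF b]] twisted_symmetric[OF b c]] diag[OF c]])
  show ?thesis
    using add_mem[OF diff_mem[OF diff_mem[OF L 1] 5] add_mem[OF add_mem[OF 2 3] 4]]
    by (simp add: algebra_simps)
qed

end

subsection \<open>Quotients and free abelian groups\<close>

lemma quotient_class_eq_one_iff:
  assumes "comm_group G" "S \<subseteq> carrier G" "a \<in> carrier G"
  shows "quotient_class G S a = \<one>\<^bsub>quotient_by G S\<^esub> \<longleftrightarrow> a \<in> generate G S"
proof -
  interpret comm_group G by fact
  have "subgroup (generate G S) G"
    using assms by (intro generate_is_subgroup)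
  then show ?thesis
    using assms(3) coset_join1 coset_join2
    by (auto simp: quotient_class_def quotient_by_def FactGroup_def)
qed

lemma quotient_class_surj:
  "quotient_class G S ` carrier G = carrier (quotient_by G S)"
  by (auto simp: quotient_class_def quotient_by_def FactGroup_def RCOSETS_def)

lemma quotient_class_group_hom:
  assumes "comm_group G" "S \<subseteq> carrier G"
  shows "group_hom G (quotient_by G S) (quotient_class G S)"
  using assms
  by (simp add: group_hom_def group_hom_axioms_def comm_group.axioms(2) quotient_class_hom comm_group_quotient_by)

text \<open>Dividing first by \<open>S\<close> and then by the image of \<open>U\<close> has the
  same kernel as dividing by both at once. This reduces the iterated quotient of the tensor square
  to a single subgroup of chains.\<close>

lemma quotient_class_quotient_eq_one_iff:
  assumes G: "comm_group G" and S: "S \<subseteq> carrier G" and U: "U \<subseteq> carrier G" and a: "a \<in> carrier G"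
  defines "H \<equiv> quotient_by G S" and "V \<equiv> quotient_class G S ` U"
  shows "quotient_class H V (quotient_class G S a) = \<one>\<^bsub>quotient_by H V\<^esub> \<longleftrightarrow>
    a \<in> generate G (S \<union> U)"
proof -
  interpret G: comm_group G by fact
  interpret q: group_hom G H "quotient_class G S"
    unfolding H_def by (rule quotient_class_group_hom[OF G S])
  have H: "comm_group H"
    unfolding H_def by (rule comm_group_quotient_by[OF G S])
  have V: "V \<subseteq> carrier H"
    using U by (auto simp: V_def)
  have gen: "subgroup (generate G (S \<union> U)) G"
    using S U by (intro G.generate_is_subgroup) auto
  have "quotient_class G S a \<in> generate H V \<longleftrightarrow> a \<in> generate G (S \<union> U)"
  proof
    assume "quotient_class G S a \<in> generate H V"
    \<comment> \<open>A subgroup generated by images is the image of the generated subgroup, so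
      \<open>a\<close> differs from some \<open>u\<close> only by an element of
      \<open>generate G S\<close>.\<close>
    then obtain u where u: "u \<in> generate G U" "quotient_class G S a = quotient_class G S u"
      using q.generate_img[OF U] by (auto simp: V_def)
    have uG: "u \<in> carrier G"
      using G.generate_in_carrier[OF U u(1)] .
    have "quotient_class G S (a \<otimes>\<^bsub>G\<^esub> inv\<^bsub>G\<^esub> u) = \<one>\<^bsub>H\<^esub>"
      using a uG u(2) by simp
    moreover have "a \<otimes>\<^bsub>G\<^esub> inv\<^bsub>G\<^esub> u \<in> carrier G"
      using a uG by simp
    ultimately have "a \<otimes>\<^bsub>G\<^esub> inv\<^bsub>G\<^esub> u \<in> generate G S"
      using quotient_class_eq_one_iff[OF G S] unfolding H_def by blast
    moreover have "u \<in> generate G (S \<union> U)"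
      using u(1) G.mono_generate[of U "S \<union> U"] by auto
    ultimately have "(a \<otimes>\<^bsub>G\<^esub> inv\<^bsub>G\<^esub> u) \<otimes>\<^bsub>G\<^esub> u \<in> generate G (S \<union> U)"
      using G.mono_generate[of S "S \<union> U"] by (intro generate.eng[of "a \<otimes>\<^bsub>G\<^esub> inv\<^bsub>G\<^esub> u"]) auto
    then show "a \<in> generate G (S \<union> U)"
      using a uG by (simp add: G.m_assoc)
  next
    assume "a \<in> generate G (S \<union> U)"
    then have "quotient_class G S a \<in> quotient_class G S ` generate G (S \<union> U)"
      by simp
    also have "\<dots> = generate H (quotient_class G S ` (S \<union> U))"
      using S U by (intro q.generate_img[symmetric]) auto
    also have "\<dots> \<subseteq> generate H V"
    proof (rule q.H.generate_subgroup_incl[OF _ q.H.generate_is_subgroup[OF V]])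
      have "quotient_class G S x = \<one>\<^bsub>H\<^esub>" if "x \<in> S" for x
        using quotient_class_eq_one_iff[OF G S, of x] that S generate.incl[of x S G]
        by (auto simp: H_def)
      then show "quotient_class G S ` (S \<union> U) \<subseteq> generate H V"
        by (auto simp: V_def intro: generate.incl generate.one)
    qed
    finally show "quotient_class G S a \<in> generate H V" .
  qed
  then show ?thesis
    using quotient_class_eq_one_iff[OF H V] a by simp
qed

text \<open>With 0 available, closure under subtraction alone accounts for negatives and
  sums.\<close>

lemma generate_free_Abelian_group_induct [consumes 2, case_names incl zero diff]:
  assumes "c \<in> generate (free_Abelian_group B) S" "S \<subseteq> carrier (free_Abelian_group B)"
    and incl: "\<And>a. a \<in> S \<Longrightarrow> P a"
    and zero: "P 0"
    and diff: "\<And>a b. \<lbrakk>P a; P b\<rbrakk> \<Longrightarrow> P (a - b)"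
  shows "P c"
proof -
  have neg: "P (- a)" if "P a" for a
    using diff[OF zero that] by simp
  have add: "P (a + b)" if "P a" "P b" for a b
    using diff[OF that(1) neg[OF that(2)]] by simp
  show ?thesis
    using assms(1)
  proof (induction rule: generate.induct)
    case (inv h)
    then show ?case
      using assms(2) incl neg by (force simp: subset_iff)
  qed (auto simp: zero incl add)
qed

lemma diff_closed_generate_free_Abelian_group:
  assumes "S \<subseteq> carrier (free_Abelian_group B)"
  shows "diff_closed (generate (free_Abelian_group B) S)"
proof
  let ?F = "free_Abelian_group B"
  interpret subgroup "generate ?F S" ?F
    using assms by (intro group.generate_is_subgroup) auto
  show "0 \<in> generate ?F S"
    using one_closed by simp
  fix a b assume a: "a \<in> generate ?F S" and b: "b \<in> generate ?F S"
  have "Poly_Mapping.keys b \<subseteq> B"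
    using mem_carrier[OF b] by simp
  then show "a - b \<in> generate ?F S"
    using m_closed[OF a m_inv_closed[OF b]] by simp
qed

lemma frag_extend_mem_free_Abelian_group:
  assumes "c \<in> carrier (free_Abelian_group B)"
    and "\<And>x. x \<in> B \<Longrightarrow> k x \<in> carrier (free_Abelian_group C)"
  shows "frag_extend k c \<in> carrier (free_Abelian_group C)"
  using assms
  by (intro carrier_free_Abelian_group_iff[THEN iffD2] order.trans[OF keys_frag_extend]) fastforce

section \<open>The group of 2-cycles\<close>

lemma rack_cycle_group2_eq:
  assumes "quandle Q qop"
  shows "rack_cycle_group2 Q qop = (free_Abelian_group (Q \<times> Q))\<lparr>carrier := rack_cycles2 Q qop\<rparr>"
  using carrier_rack_cycle_group2[OF assms]
  by (simp add: rack_cycle_group2_def subgroup_generated_def)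

lemma rack_cycles2_subgroup:
  assumes "quandle Q qop"
  shows "subgroup (rack_cycles2 Q qop) (free_Abelian_group (Q \<times> Q))"
proof -
  interpret group_hom "free_Abelian_group (Q \<times> Q)" "free_Abelian_group Q" "rack_boundary2 qop"
    by (simp add: group_hom_def group_hom_axioms_def rack_boundary2_hom assms)
  show ?thesis
    unfolding rack_cycles2_def by (rule subgroup_kernel)
qed

lemma comm_group_rack_cycle_group2: "comm_group (rack_cycle_group2 Q qop)"
  unfolding rack_cycle_group2_def
  by (intro group.abelian_subgroup_generated abelian_free_Abelian_group group_free_Abelian_group)

lemma generate_rack_cycle_group2:
  assumes "quandle Q qop" "S \<subseteq> rack_cycles2 Q qop"
  shows "generate (rack_cycle_group2 Q qop) S = generate (free_Abelian_group (Q \<times> Q)) S"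
  unfolding rack_cycle_group2_eq[OF assms(1)]
  using assms by (intro group.generate_consistent rack_cycles2_subgroup) auto

subsection \<open>The second homology of an Alexander quandle\<close>

context alexander
begin

abbreviation "X \<equiv> carrier A"
abbreviation "F \<equiv> free_Abelian_group (X \<times> X)"
abbreviation "Z \<equiv> rack_cycles2 X (alexander_op A t)"

text \<open>Lifts of \<open>alexander_tensor_relations\<close> to chains, which make
  \<open>K\<close> the kernel of the projection from \<open>F\<close> to the final quotient.\<close>

definition "tensor_twists =
  {frag_of (x, y) - frag_of (y, t x) | x y. x \<in> X \<and> y \<in> X}"

definition "K = generate F (tensor_relations A A \<union> tensor_twists)"

definition "R = generate F (quandle_relations2 X (alexander_op A t))"

definition "\<Phi> = frag_extend (\<lambda>(x, y). frag_of (x, s y))"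

definition "\<Psi> = frag_extend (\<lambda>(x, y). frag_of (x, r y))"

definition "\<sigma> = frag_extend (\<lambda>x. frag_of (\<one>, r x))"

text \<open>
  \<open>\<rho>\<close> retracts the chains onto the cycles: \<open>\<sigma>\<close> satisfies
  $\partial_2 (\sigma (x)) = (0) - (x)$, since $0 * (1 - t)^{-1} x = x$.
\<close>

definition "\<rho> c = c + \<sigma> (rack_boundary2 (alexander_op A t) c)"

lemma quandle: "quandle X (alexander_op A t)"
  by (rule quandle_alexander[OF comm_group_axioms t_iso])

lemma r_one [simp]: "r \<one> = \<one>"
  using r_s[of \<one>] by simp

lemma linear [simp]:
  "\<Phi> 0 = 0" "\<Phi> (c - d) = \<Phi> c - \<Phi> d" "\<Phi> (c + d) = \<Phi> c + \<Phi> d"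
  "\<Psi> 0 = 0" "\<Psi> (c - d) = \<Psi> c - \<Psi> d"
  "\<sigma> 0 = 0" "\<sigma> (u - v) = \<sigma> u - \<sigma> v"
  "\<rho> 0 = 0" "\<rho> (c - d) = \<rho> c - \<rho> d" "\<rho> (c + d) = \<rho> c + \<rho> d"
  by (simp_all add: \<Phi>_def \<Psi>_def \<rho>_def \<sigma>_def rack_boundary2_def frag_extend_diff frag_extend_add)

lemma frag_of_simps [simp]:
  "\<Phi> (frag_of (x, y)) = frag_of (x, s y)"
  "\<Psi> (frag_of (x, y)) = frag_of (x, r y)"
  "\<sigma> (frag_of x) = frag_of (\<one>, r x)"
  by (simp_all add: \<Phi>_def \<Psi>_def \<sigma>_def)

lemma \<rho>_frag_of [simp]:
  "\<rho> (frag_of (x, y)) = frag_of (x, y) + frag_of (\<one>, r x) - frag_of (\<one>, r (alexander_op A t x y))"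
  by (simp add: \<rho>_def \<sigma>_def rack_boundary2_def frag_extend_diff)

lemma \<rho>_cycle: "c \<in> Z \<Longrightarrow> \<rho> c = c"
  by (simp add: \<rho>_def rack_cycles2_def kernel_def)

lemma rack_boundary2_\<rho>:
  assumes "c \<in> carrier F"
  shows "rack_boundary2 (alexander_op A t) (\<rho> c) = 0"
proof -
  have "Poly_Mapping.keys c \<subseteq> X \<times> X"
    using assms by simp
  then show ?thesis
  proof (induction c rule: frag_induction)
    \<comment> \<open>The correction terms contribute (0) - (x) and (x * y) - (0), which cancel the
      boundary (x) - (x * y).\<close>
    case (one p)
    then show ?case
      by (auto simp: rack_boundary2_def frag_extend_diff frag_extend_add alexander_op_def)
  qed (auto simp: rack_boundary2_def frag_extend_diff)
qed

lemma \<Phi>_closed: "c \<in> carrier F \<Longrightarrow> \<Phi> c \<in> carrier F"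
  unfolding \<Phi>_def by (erule frag_extend_mem_free_Abelian_group) auto

lemma \<Psi>_closed: "c \<in> carrier F \<Longrightarrow> \<Psi> c \<in> carrier F"
  unfolding \<Psi>_def by (erule frag_extend_mem_free_Abelian_group) auto

lemma \<rho>_in_cycles:
  assumes c: "c \<in> carrier F"
  shows "\<rho> c \<in> Z"
proof -
  have "rack_boundary2 (alexander_op A t) c \<in> carrier (free_Abelian_group X)"
    using rack_boundary2_hom[OF quandle] c by (rule hom_in_carrier)
  then have "\<sigma> (rack_boundary2 (alexander_op A t) c) \<in> carrier F"
    unfolding \<sigma>_def by (rule frag_extend_mem_free_Abelian_group) auto
  then have "\<rho> c \<in> carrier F"
    unfolding \<rho>_def using c monoid.m_closed[of F] group.is_monoid[of F]
    by (metis group_free_Abelian_group mult_free_Abelian_group)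
  then show ?thesis
    using rack_boundary2_\<rho>[OF c] by (simp add: rack_cycles2_def kernel_def)
qed

lemma \<Phi>_\<Psi>:
  assumes "c \<in> carrier F"
  shows "\<Phi> (\<Psi> c) = c"
proof -
  have "Poly_Mapping.keys c \<subseteq> X \<times> X"
    using assms by simp
  then show ?thesis
    by (induction c rule: frag_induction) auto
qed

lemma \<Psi>_\<Phi>:
  assumes "c \<in> carrier F"
  shows "\<Psi> (\<Phi> c) = c"
proof -
  have "Poly_Mapping.keys c \<subseteq> X \<times> X"
    using assms by simp
  then show ?thesis
    by (induction c rule: frag_induction) auto
qed

section \<open>The two families of relations\<close>

lemma tensor_twists_subset: "tensor_twists \<subseteq> carrier F"
proof -
  have "Poly_Mapping.keys (frag_of (x, y) - frag_of (y, t x)) \<subseteq> X \<times> X" if "x \<in> X" "y \<in> X" for x y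
    using keys_diff[of "frag_of (x, y)" "frag_of (y, t x)"] that by auto
  then show ?thesis
    by (auto simp: tensor_twists_def)
qed

lemma K_generators_subset: "tensor_relations A A \<union> tensor_twists \<subseteq> carrier F"
  using tensor_relations_subset[OF is_group is_group] tensor_twists_subset by (rule Un_least)

lemma quandle_relations2_subset_F: "quandle_relations2 X (alexander_op A t) \<subseteq> carrier F"
  using quandle_relations2_subset[OF quandle] by (auto simp: rack_cycles2_def kernel_def)

lemma alexander_bilinear_K: "alexander_bilinear A t K (\<lambda>x y. frag_of (x, y))"
proof -
  interpret diff_closed K
    unfolding K_def by (rule diff_closed_generate_free_Abelian_group[OF K_generators_subset])
  have incl: "a \<in> K" if "a \<in> tensor_relations A A \<union> tensor_twists" for a
    using that unfolding K_def by (rule generate.incl)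
  show ?thesis
  proof
    fix x x' y assume x: "x \<in> X" "x' \<in> X" and y: "y \<in> X"
    show "frag_of (x \<otimes> x', y) - frag_of (x, y) - frag_of (x', y) \<in> K"
      using x y by (intro incl, unfold tensor_relations_def) blast
    show "frag_of (y, x \<otimes> x') - frag_of (y, x) - frag_of (y, x') \<in> K"
      using x y by (intro incl, unfold tensor_relations_def) blast
    show "frag_of (x, y) - frag_of (y, t x) \<in> K"
      using x y by (intro incl, unfold tensor_twists_def) blast
  qed
qed

lemma alexander_cocycle_R: "alexander_cocycle A t R (\<lambda>x y. \<rho> (frag_of (x, r y)))"
proof -
  interpret diff_closed R
    unfolding R_def by (rule diff_closed_generate_free_Abelian_group[OF quandle_relations2_subset_F])
  have diag: "frag_of (x, x) \<in> R" if "x \<in> X" for x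
    using that by (auto simp: R_def quandle_relations2_def intro!: generate.incl)
  show ?thesis
  proof
    fix x assume x: "x \<in> X"
    \<comment> \<open>Since 0 * r(x) = x, the correction terms leave only the degenerate pair (0,
      0).\<close>
    show "\<rho> (frag_of (\<one>, r x)) \<in> R"
      using x diag[of \<one>] by (simp add: alexander_op_def)
    \<comment> \<open>Here r((1 - t) x) = x, and idempotence makes the correction terms
      cancel.\<close>
    show "\<rho> (frag_of (x, r (s x))) \<in> R"
      using x diag[of x] by (simp add: alexander_op_def)
  next
    fix x b c assume x: "x \<in> X" and b: "b \<in> X" and c: "c \<in> X"
    let ?e = "rack_boundary3 (alexander_op A t) (frag_of (x, r b, r c))"
    have e: "?e \<in> quandle_relations2 X (alexander_op A t)"
      using x b c by (simp add: quandle_relations2_def)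
    \<comment> \<open>A boundary is a cycle and hence fixed by \<open>\<rho>\<close>, which can then
      be distributed over the four terms.\<close>
    have "?e = \<rho> ?e"
      using \<rho>_cycle[of ?e] e quandle_relations2_subset[OF quandle] by auto
    also have "\<dots> = \<rho> (frag_of (x, r c)) - \<rho> (frag_of (t x \<otimes> b, r c)) - \<rho> (frag_of (x, r b)) +
        \<rho> (frag_of (t x \<otimes> c, r (t b \<otimes> s c)))"
      using x b c by (simp add: rack_boundary3_def alexander_op_def t_r del: \<rho>_frag_of)
    finally show "\<rho> (frag_of (x, r c)) - \<rho> (frag_of (t x \<otimes> b, r c)) - \<rho> (frag_of (x, r b)) +
        \<rho> (frag_of (t x \<otimes> c, r (t b \<otimes> s c))) \<in> R"
      using e generate.incl[OF e, of F] by (simp add: R_def)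
  qed
qed

interpretation K: alexander_bilinear A t K "\<lambda>x y. frag_of (x, y)"
  by (rule alexander_bilinear_K)

interpretation R: alexander_cocycle A t R "\<lambda>x y. \<rho> (frag_of (x, r y))"
  by (rule alexander_cocycle_R)

section \<open>Comparison of the subgroups R and K\<close>

lemma \<Phi>_boundary3:
  assumes "Poly_Mapping.keys u \<subseteq> X \<times> X \<times> X"
  shows "\<Phi> (rack_boundary3 (alexander_op A t) u) \<in> K"
  using assms
proof (induction u rule: frag_induction)
  case zero
  then show ?case by (simp add: rack_boundary3_def K.zero_mem)
next
  case (one p)
  then obtain x y z where p: "p = (x, y, z)" "x \<in> X" "y \<in> X" "z \<in> X"
    by auto
  have "\<Phi> (rack_boundary3 (alexander_op A t) (frag_of p)) =
      frag_of (x, s z) - frag_of (t x \<otimes> s y, s z) - frag_of (x, s y) +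
      frag_of (t x \<otimes> s z, t (s y) \<otimes> s (s z))"
    using p by (simp add: rack_boundary3_def alexander_op_def t_s)
  then show ?case
    using K.boundary[of x "s y" "s z"] p by simp
next
  case (diff a b)
  then show ?case by (simp add: rack_boundary3_def frag_extend_diff K.diff_mem)
qed

lemma \<Phi>_R_subset:
  assumes "c \<in> R" shows "\<Phi> c \<in> K"
  using assms quandle_relations2_subset_F unfolding R_def
proof (induction c rule: generate_free_Abelian_group_induct)
  case (incl c)
  then show ?case
    using \<Phi>_boundary3 K.diag by (auto simp: quandle_relations2_def)
next
  case zero
  show ?case by (simp add: K.zero_mem)
next
  case (diff a b)
  then show ?case by (simp add: K.diff_mem)
qed

text \<open>Each kind of generator of \<open>K\<close> matches one property of the cocycle modulo
  \<open>R\<close>: additivity on either side or twisted symmetry. So the candidate inverse is well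
  defined.\<close>

lemma \<rho>_\<Psi>_K_subset:
  assumes "d \<in> K" shows "\<rho> (\<Psi> d) \<in> R"
  using assms K_generators_subset unfolding K_def
proof (induction d rule: generate_free_Abelian_group_induct)
  case (incl d)
  then consider
      (left) x x' y where "d = frag_of (x \<otimes> x', y) - frag_of (x, y) - frag_of (x', y)"
        "x \<in> X" "x' \<in> X" "y \<in> X"
    | (right) x y y' where "d = frag_of (x, y \<otimes> y') - frag_of (x, y) - frag_of (x, y')"
        "x \<in> X" "y \<in> X" "y' \<in> X"
    | (twist) x y where "d = frag_of (x, y) - frag_of (y, t x)" "x \<in> X" "y \<in> X"
    unfolding tensor_relations_def tensor_twists_def by blast
  then show ?case
  proof cases
    case left
    then show ?thesis
      using R.add_left[of x x' y] by (simp del: \<rho>_frag_of)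
  next
    case right
    then show ?thesis
      using R.add_right[of x y y'] by (simp del: \<rho>_frag_of)
  next
    case twist
    then show ?thesis
      using R.twisted_symmetric[of x y] by (simp del: \<rho>_frag_of)
  qed
qed (simp_all add: R.zero_mem R.diff_mem)

text \<open>Injectivity on homology: for a cycle \<open>c\<close>,
  \<open>\<rho> (\<Psi> (\<Phi> c))\<close> is \<open>c\<close> itself, so membership in
  \<open>K\<close> can be carried back to \<open>R\<close>.\<close>

lemma \<Phi>_mem_K_iff:
  assumes "c \<in> Z" shows "\<Phi> c \<in> K \<longleftrightarrow> c \<in> R"
proof -
  have "c \<in> carrier F"
    using assms by (simp add: rack_cycles2_def kernel_def)
  then show ?thesis
    using \<rho>_\<Psi>_K_subset[of "\<Phi> c"] \<Phi>_R_subset[of c] assms by (auto simp: \<Psi>_\<Phi> \<rho>_cycle)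
qed

text \<open>Surjectivity: the retraction alters a chain only by multiples of pairs (0, r x), which
  \<open>\<Phi>\<close> sends to (0, x), a chain in \<open>K\<close> because the tensor of 0 with x
  is zero.\<close>

lemma \<Phi>_\<rho>_\<Psi>:
  assumes "d \<in> carrier F" shows "\<Phi> (\<rho> (\<Psi> d)) - d \<in> K"
proof -
  have "\<Phi> (\<sigma> u) \<in> K" if "Poly_Mapping.keys u \<subseteq> X" for u
    using that
    by (induction u rule: frag_induction) (simp_all add: K.zero_mem K.diff_mem K.one_left)
  moreover have "rack_boundary2 (alexander_op A t) (\<Psi> d) \<in> carrier (free_Abelian_group X)"
    using rack_boundary2_hom[OF quandle] \<Psi>_closed[OF assms] by (rule hom_in_carrier)
  ultimately show ?thesis
    using assms by (simp add: \<rho>_def \<Phi>_\<Psi>)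
qed

section \<open>Passage to the quotient of the tensor square\<close>

lemma alexander_tensor_relations_eq:
  "alexander_tensor_relations A t = quotient_class F (tensor_relations A A) ` tensor_twists"
proof -
  interpret q: group_hom F "tensor_product A A" "quotient_class F (tensor_relations A A)"
    unfolding tensor_product_def
    by (intro quotient_class_group_hom abelian_free_Abelian_group tensor_relations_subset is_group)
  have "pure_tensor A A x y \<otimes>\<^bsub>tensor_product A A\<^esub> inv\<^bsub>tensor_product A A\<^esub> pure_tensor A A y (t x) =
      quotient_class F (tensor_relations A A) (frag_of (x, y) - frag_of (y, t x))"
    if "x \<in> X" "y \<in> X" for x y
    using that q.hom_mult[of "frag_of (x, y)" "- frag_of (y, t x)"] q.hom_inv[of "frag_of (y, t x)"]
    by (simp add: pure_tensor_def)
  then have "alexander_tensor_relations A t =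
      {quotient_class F (tensor_relations A A) (frag_of (x, y) - frag_of (y, t x)) | x y. x \<in> X \<and> y \<in> X}"
    unfolding alexander_tensor_relations_def by (intro Collect_cong) metis
  also have "\<dots> = quotient_class F (tensor_relations A A) ` tensor_twists"
    unfolding tensor_twists_def by blast
  finally show ?thesis .
qed

definition "\<phi> = quotient_class F (tensor_relations A A) \<circ> \<Phi>"

definition "\<theta> = quotient_class (tensor_product A A) (alexander_tensor_relations A t) \<circ> \<phi>"

lemma \<Phi>_hom: "\<Phi> \<in> hom F F"
  using \<Phi>_closed by (intro homI) auto

lemma \<phi>_hom: "\<phi> \<in> hom F (tensor_product A A)"
  unfolding \<phi>_def tensor_product_def
  by (intro Group.hom_compose[OF \<Phi>_hom] quotient_class_hom abelian_free_Abelian_group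
      tensor_relations_subset is_group)

lemma alexander_tensor_relations_subset:
  "alexander_tensor_relations A t \<subseteq> carrier (tensor_product A A)"
  using hom_in_carrier[OF quotient_class_hom[OF abelian_free_Abelian_group
      tensor_relations_subset[OF is_group is_group]]] tensor_twists_subset
  unfolding alexander_tensor_relations_eq tensor_product_def by blast

abbreviation "T \<equiv> quotient_by (tensor_product A A) (alexander_tensor_relations A t)"

lemma \<theta>_group_hom: "group_hom F T \<theta>"
proof -
  have "\<theta> \<in> hom F T"
    unfolding \<theta>_def
    by (intro Group.hom_compose[OF \<phi>_hom] quotient_class_hom comm_group_tensor_product
        alexander_tensor_relations_subset is_group)
  moreover have "group T"
    by (intro comm_group.axioms comm_group_quotient_by comm_group_tensor_product
        alexander_tensor_relations_subset is_group)
  ultimately show ?thesis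
    by (simp add: group_hom_def group_hom_axioms_def)
qed

lemma tensor_quotient_class_eq_one_iff:
  assumes "d \<in> carrier F"
  shows "quotient_class (tensor_product A A) (alexander_tensor_relations A t)
      (quotient_class F (tensor_relations A A) d) = \<one>\<^bsub>T\<^esub> \<longleftrightarrow> d \<in> K"
  using quotient_class_quotient_eq_one_iff[OF abelian_free_Abelian_group
      tensor_relations_subset[OF is_group is_group] tensor_twists_subset assms]
  unfolding alexander_tensor_relations_eq tensor_product_def K_def .

lemma \<theta>_eq_one_iff: "c \<in> Z \<Longrightarrow> \<theta> c = \<one>\<^bsub>T\<^esub> \<longleftrightarrow> c \<in> R"
  using tensor_quotient_class_eq_one_iff[of "\<Phi> c"] \<Phi>_closed[of c] \<Phi>_mem_K_iff[of c]
  by (simp add: \<theta>_def \<phi>_def rack_cycles2_def kernel_def)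

lemma \<theta>_surj: "\<theta> ` Z = carrier T"
proof
  interpret \<theta>: group_hom F T \<theta> by (rule \<theta>_group_hom)
  show "\<theta> ` Z \<subseteq> carrier T"
    using \<theta>.hom_closed by (fastforce simp: rack_cycles2_def kernel_def)
  show "carrier T \<subseteq> \<theta> ` Z"
  proof
    fix u assume "u \<in> carrier T"
    then have "u \<in> quotient_class (tensor_product A A) (alexander_tensor_relations A t) `
        quotient_class F (tensor_relations A A) ` carrier F"
      by (simp only: quotient_class_surj flip: tensor_product_def)
    then obtain d where d: "d \<in> carrier F"
      and u: "u = quotient_class (tensor_product A A) (alexander_tensor_relations A t)
        (quotient_class F (tensor_relations A A) d)"
      by blast
    have u': "u = \<theta> (\<Psi> d)"
      using u d by (simp add: \<theta>_def \<phi>_def \<Phi>_\<Psi> del: carrier_free_Abelian_group_iff)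
    \<comment> \<open>The preimage \<open>\<Psi> d\<close> need not be a cycle; its retraction is
      one and has the same value under \<open>\<theta>\<close>.\<close>
    let ?c = "\<rho> (\<Psi> d)"
    have c: "?c \<in> Z" "?c \<in> carrier F"
      using \<rho>_in_cycles[OF \<Psi>_closed[OF d]] by (auto simp: rack_cycles2_def kernel_def)
    have diff: "?c - \<Psi> d \<in> carrier F"
      using c(2) \<Psi>_closed[OF d] keys_diff[of ?c "\<Psi> d"] by auto
    have "\<Phi> (?c - \<Psi> d) \<in> K"
      using \<Phi>_\<rho>_\<Psi>[OF d] d by (simp add: \<Phi>_\<Psi> del: carrier_free_Abelian_group_iff)
    then have "\<theta> (?c - \<Psi> d) = \<one>\<^bsub>T\<^esub>"
      using tensor_quotient_class_eq_one_iff[OF \<Phi>_closed[OF diff]] by (simp add: \<theta>_def \<phi>_def)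
    then have "\<theta> ?c = \<theta> (\<Psi> d)"
      using \<theta>.hom_mult[OF diff \<Psi>_closed[OF d]] \<theta>.hom_closed[OF \<Psi>_closed[OF d]]
      by simp
    then show "u \<in> \<theta> ` Z"
      using c(1) u' by auto
  qed
qed

text \<open>The first isomorphism theorem for \<open>\<theta>\<close> restricted to the cycles,
  whose kernel is \<open>R\<close>.\<close>

lemma ex_iso:
  "\<exists>h \<in> iso (quandle_homology2 X (alexander_op A t)) T.
    \<forall>c\<in>Z. h (quandle_homology_class2 X (alexander_op A t) c) = \<theta> c"
proof -
  let ?C = "rack_cycle_group2 X (alexander_op A t)"
  let ?rel = "quandle_relations2 X (alexander_op A t)"
  interpret \<theta>F: group_hom F T \<theta> by (rule \<theta>_group_hom)
  have C: "carrier ?C = Z" "\<And>a b. a \<otimes>\<^bsub>?C\<^esub> b = a + b"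
    by (simp_all add: rack_cycle_group2_eq[OF quandle])
  have ZF: "Z \<subseteq> carrier F"
    by (auto simp: rack_cycles2_def kernel_def)
  have "\<theta> \<in> hom ?C T"
  proof (rule homI)
    show "\<theta> c \<in> carrier T" if "c \<in> carrier ?C" for c
      using that ZF C(1) \<theta>F.hom_closed by blast
    show "\<theta> (c \<otimes>\<^bsub>?C\<^esub> d) = \<theta> c \<otimes>\<^bsub>T\<^esub> \<theta> d" if "c \<in> carrier ?C" "d \<in> carrier ?C" for c d
      using \<theta>F.hom_mult[of c d] subsetD[OF ZF, of c] subsetD[OF ZF, of d] that C by simp
  qed
  then interpret \<theta>: group_hom ?C T \<theta>
    by (simp add: group_hom_def group_hom_axioms_def comm_group.axioms comm_group_rack_cycle_group2)
  have R: "R = generate ?C ?rel"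
    by (simp add: R_def generate_rack_cycle_group2[OF quandle quandle_relations2_subset[OF quandle]])
  have rel: "?rel \<subseteq> carrier ?C"
    using quandle_relations2_subset[OF quandle] C(1) by simp
  have "R \<subseteq> Z"
    unfolding R using \<theta>.G.generate_incl[OF rel] C(1) by simp
  then have ker: "kernel ?C T \<theta> = R"
    using C(1) \<theta>_eq_one_iff by (auto simp: kernel_def)
  \<comment> \<open>Sends a coset to the single value that \<open>\<theta>\<close> takes on
    it.\<close>
  let ?h = "\<lambda>S. the_elem (\<theta> ` S)"
  have h_iso: "?h \<in> iso (quandle_homology2 X (alexander_op A t)) T"
    unfolding quandle_homology2_def quotient_by_def[of ?C] R[symmetric] ker[symmetric]
    by (rule \<theta>.FactGroup_iso_set) (simp add: C(1) \<theta>_surj)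
  have h_class: "?h (quandle_homology_class2 X (alexander_op A t) c) = \<theta> c" if "c \<in> Z" for c
  proof -
    have c: "c \<in> carrier ?C"
      using that C(1) by simp
    have "\<theta> y = \<theta> c" if y: "y \<in> R #>\<^bsub>?C\<^esub> c" for y
    proof -
      obtain k where "k \<in> R" "y = k \<otimes>\<^bsub>?C\<^esub> c"
        using y by (auto simp: r_coset_def)
      moreover have "k \<in> carrier ?C" "\<theta> k = \<one>\<^bsub>T\<^esub>"
        using \<open>k \<in> R\<close> \<open>R \<subseteq> Z\<close> C(1) \<theta>_eq_one_iff by auto
      ultimately show ?thesis
        using c by simp
    qed
    moreover have "c \<in> R #>\<^bsub>?C\<^esub> c"
      unfolding R by (rule \<theta>.G.rcos_self[OF c \<theta>.G.generate_is_subgroup[OF rel]])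
    ultimately have "the_elem (\<theta> ` (R #>\<^bsub>?C\<^esub> c)) = \<theta> c"
      by (intro the_elem_image_unique) blast+
    then show ?thesis
      by (simp only: quandle_homology_class2_def quotient_class_def R)
  qed
  show ?thesis
    by (intro bexI[of _ ?h] ballI h_class h_iso)
qed

end

text \<open>A homomorphism on a free abelian group is determined by its values on the generators,
  and every homology class has a cycle representative. The clauses on \<open>\<phi>\<close> and on
  cycles therefore pin down \<open>h\<close> as the map induced by the given correspondence.\<close>

theorem theorem4p1:
  fixes A :: "('a, 'b) monoid_scheme" and t :: "'a \<Rightarrow> 'a"
  assumes "comm_group A"
    and "t \<in> iso A A"
    and "one_minus A t \<in> iso A A"
  shows "\<exists>\<phi> h.
    \<phi> \<in> hom (free_Abelian_group (carrier A \<times> carrier A)) (tensor_product A A) \<and>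
    (\<forall>x\<in>carrier A. \<forall>y\<in>carrier A.
       \<phi> (frag_of (x, y)) = pure_tensor A A x (one_minus A t y)) \<and>
    h \<in> iso (quandle_homology2 (carrier A) (alexander_op A t))
            (quotient_by (tensor_product A A) (alexander_tensor_relations A t)) \<and>
    (\<forall>c \<in> rack_cycles2 (carrier A) (alexander_op A t).
       h (quandle_homology_class2 (carrier A) (alexander_op A t) c) =
       quotient_class (tensor_product A A) (alexander_tensor_relations A t) (\<phi> c))"
proof -
  interpret alexander A t
    using assms by (simp add: alexander_def alexander_axioms_def)
  obtain h where "h \<in> iso (quandle_homology2 X (alexander_op A t)) T"
    and "\<forall>c\<in>Z. h (quandle_homology_class2 X (alexander_op A t) c) = \<theta> c"
    using ex_iso by blast
  moreover have "\<phi> (frag_of (x, y)) = pure_tensor A A x (s y)" for x y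
    by (simp add: \<phi>_def pure_tensor_def)
  ultimately show ?thesis
    using \<phi>_hom by (intro exI[of _ \<phi>] exI[of _ h]) (simp add: \<theta>_def)
qed

end
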